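(* Let $\bm{\mu}=(\alpha,\beta,\gamma;\alpha',\beta',\gamma')$ be parameters (complex numbers) with $\beta\ne0$, and let $F(x,y)=F(x,y;\bm{\mu})$ be the solution of $$-(\beta+\beta'x)\,x\,\frac{\partial F}{\partial x}+(1-\alpha y-\alpha'xy)\,\frac{\partial F}{\partial y}=\bigl(\alpha+\gamma+(\alpha'+\beta'+\gamma')x\bigr)F$$ with initial condition $F(x,0)=1$. Then $$\widehat F(x,y)=F\left(\frac{\beta x}{\beta-\beta'x},\;y\,\frac{\beta-\beta'x}{\beta};\;\bm{\mu}\right)$$ is a solution of the same equation with the parameters $\bm{\mu}$ replaced by $$\bm{\widehat\mu}=\left(\alpha,\beta,\gamma;\;\alpha'+\beta'-\frac{\alpha\beta'}{\beta},\;-\beta',\;\gamma'+\beta'-\frac{\gamma\beta'}{\beta}\right),$$ and it satisfies the initial condition $\widehat F(x,0)=1$.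
   Context: Solutions are understood as formal power series in $x,y$ (in the paper they are exponential generating functions $\sum_{n,k\ge0}a_{n,k}x^k y^n/n!$). "The same equation with parameters $\bm{\widehat\mu}=(\widehat\alpha,\widehat\beta,\widehat\gamma;\widehat\alpha',\widehat\beta',\widehat\gamma')$" means the displayed partial differential equation with $\alpha,\beta,\gamma,\alpha',\beta',\gamma'$ replaced by $\widehat\alpha,\widehat\beta,\widehat\gamma,\widehat\alpha',\widehat\beta',\widehat\gamma'$ respectively. The expression $\frac{\beta x}{\beta-\beta'x}$ is expanded as a power series in $x$. *)

theory Defs
  imports "HOL-Computational_Algebra.Formal_Power_Series"
begin

unbundle fps_syntax

text \<open>
  A formal power series in \<open>x, y\<close> is a power series in \<open>y\<close> whose coefficients are power
  series in \<open>x\<close>: the coefficient of \<open>x\<^sup>k y\<^sup>n\<close> in \<open>F\<close> is \<open>F $ n $ k\<close>.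
\<close>

type_synonym fps2 = "complex fps fps"

definition const2 :: "complex \<Rightarrow> fps2" where
  "const2 c = fps_const (fps_const c)"

definition X2 :: fps2 where
  "X2 = fps_const fps_X"

definition Y2 :: fps2 where
  "Y2 = fps_X"

definition deriv_x :: "fps2 \<Rightarrow> fps2" where
  "deriv_x F = Abs_fps (\<lambda>n. fps_deriv (F $ n))"

definition deriv_y :: "fps2 \<Rightarrow> fps2" where
  "deriv_y F = fps_deriv F"

definition solves_pde ::
    "complex \<Rightarrow> complex \<Rightarrow> complex \<Rightarrow> complex \<Rightarrow> complex \<Rightarrow> complex \<Rightarrow> fps2 \<Rightarrow> bool" where
  "solves_pde \<alpha> \<beta> \<gamma> \<alpha>' \<beta>' \<gamma>' F \<longleftrightarrow>
     - (const2 \<beta> + const2 \<beta>' * X2) * X2 * deriv_x F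
       + (1 - const2 \<alpha> * Y2 - const2 \<alpha>' * X2 * Y2) * deriv_y F
     = (const2 (\<alpha> + \<gamma>) + const2 (\<alpha>' + \<beta>' + \<gamma>') * X2) * F"

text \<open>The value \<open>F(x, 0)\<close>.\<close>

definition at_y0 :: "fps2 \<Rightarrow> complex fps" where
  "at_y0 F = F $ 0"

text \<open>
  The simultaneous substitution \<open>F(u(x), w(x, y))\<close>. It is meaningful when \<open>u\<close> has no constant
  term and \<open>w\<close> has no term free of \<open>y\<close>.
\<close>

definition subst2 :: "fps2 \<Rightarrow> complex fps \<Rightarrow> fps2 \<Rightarrow> fps2" where
  "subst2 F u w = fps_compose (Abs_fps (\<lambda>n. fps_compose (F $ n) u)) w"

lemma solves_pde_iff:
  "solves_pde \<alpha> \<beta> \<gamma> \<alpha>' \<beta>' \<gamma>' F \<longleftrightarrow>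
     (\<forall>n. of_nat (Suc n) * F $ Suc n =
        (fps_const (\<alpha> + \<gamma>) + fps_const (\<alpha>' + \<beta>' + \<gamma>') * fps_X
           + of_nat n * (fps_const \<alpha> + fps_const \<alpha>' * fps_X)) * F $ n
        + (fps_const \<beta> + fps_const \<beta>' * fps_X) * fps_X * fps_deriv (F $ n))"
proof -
  let ?p = "fps_const \<beta> + fps_const \<beta>' * fps_X"
  let ?q = "fps_const \<alpha> + fps_const \<alpha>' * fps_X"
  let ?r = "fps_const (\<alpha> + \<gamma>) + fps_const (\<alpha>' + \<beta>' + \<gamma>') * fps_X"
  have lhs: "- (const2 \<beta> + const2 \<beta>' * X2) * X2 * deriv_x F
       + (1 - const2 \<alpha> * Y2 - const2 \<alpha>' * X2 * Y2) * deriv_y F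
     = fps_const (- (?p * fps_X)) * deriv_x F + deriv_y F - fps_const ?q * (fps_X * fps_deriv F)"
    unfolding const2_def X2_def Y2_def deriv_y_def
    by (simp add: algebra_simps flip: fps_const_mult fps_const_add fps_const_neg fps_const_sub)
  have rhs: "(const2 (\<alpha> + \<gamma>) + const2 (\<alpha>' + \<beta>' + \<gamma>') * X2) * F = fps_const ?r * F"
    unfolding const2_def X2_def by simp
  have yd: "(fps_X * fps_deriv F) $ n = of_nat n * F $ n" for n
    by (cases n) simp_all
  have "solves_pde \<alpha> \<beta> \<gamma> \<alpha>' \<beta>' \<gamma>' F \<longleftrightarrow>
     (\<forall>n. - (?p * fps_X) * fps_deriv (F $ n) + of_nat (Suc n) * F $ Suc n
            - ?q * (of_nat n * F $ n) = ?r * F $ n)"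
    unfolding solves_pde_def lhs rhs fps_eq_iff[where 'a = "complex fps"]
    by (simp only: fps_add_nth fps_sub_nth fps_mult_left_const_nth yd deriv_x_def deriv_y_def
        fps_deriv_nth fps_nth_Abs_fps Suc_eq_plus1)
  also have "\<dots> \<longleftrightarrow> (\<forall>n. of_nat (Suc n) * F $ Suc n =
        (?r + of_nat n * ?q) * F $ n + ?p * fps_X * fps_deriv (F $ n))"
    by (intro all_cong1) (auto simp: algebra_simps)
  finally show ?thesis .
qed

lemma solution_unique:
  "\<exists>!F. solves_pde \<alpha> \<beta> \<gamma> \<alpha>' \<beta>' \<gamma>' F \<and> at_y0 F = 1"
proof -
  define G where "G n f =
        (fps_const (\<alpha> + \<gamma>) + fps_const (\<alpha>' + \<beta>' + \<gamma>') * fps_X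
           + of_nat n * (fps_const \<alpha> + fps_const \<alpha>' * fps_X)) * f
        + (fps_const \<beta> + fps_const \<beta>' * fps_X) * fps_X * fps_deriv f"
    for n :: nat and f :: "complex fps"
  have iff: "solves_pde \<alpha> \<beta> \<gamma> \<alpha>' \<beta>' \<gamma>' F \<longleftrightarrow>
      (\<forall>n. of_nat (Suc n) * F $ Suc n = G n (F $ n))" for F
    unfolding solves_pde_iff G_def ..
  have inv: "of_nat (Suc n) * (fps_const (1 / of_nat (Suc n)) * f) = f"
    for n and f :: "complex fps"
  proof -
    have "(of_nat (Suc n) :: complex fps) * fps_const (1 / of_nat (Suc n))
        = fps_const (of_nat (Suc n) * (1 / of_nat (Suc n)))"
      by (simp only: fps_of_nat[symmetric] fps_const_mult)
    also have "\<dots> = 1"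
      by (simp del: of_nat_Suc)
    finally show ?thesis
      by (simp only: mult.assoc[symmetric] mult_1)
  qed
  define s where "s = rec_nat 1 (\<lambda>n f. fps_const (1 / of_nat (Suc n)) * G n f)"
  have "solves_pde \<alpha> \<beta> \<gamma> \<alpha>' \<beta>' \<gamma>' (Abs_fps s) \<and> at_y0 (Abs_fps s) = 1"
    unfolding iff at_y0_def by (simp only: fps_nth_Abs_fps) (simp add: s_def inv del: of_nat_Suc)
  moreover have "F = H"
    if "solves_pde \<alpha> \<beta> \<gamma> \<alpha>' \<beta>' \<gamma>' F \<and> at_y0 F = 1"
       "solves_pde \<alpha> \<beta> \<gamma> \<alpha>' \<beta>' \<gamma>' H \<and> at_y0 H = 1" for F H
  proof -
    have "F $ n = H $ n" for n
    proof (induction n)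
      case 0
      then show ?case using that by (simp add: at_y0_def)
    next
      case (Suc n)
      have "of_nat (Suc n) * F $ Suc n = of_nat (Suc n) * H $ Suc n"
        using that Suc iff by metis
      then show ?case by (simp del: of_nat_Suc)
    qed
    then show ?thesis by (simp add: fps_eq_iff[where 'a = "complex fps"])
  qed
  ultimately show ?thesis by blast
qed

end

theory Submission imports Defs begin

text \<open>
  Write \<open>b = \<beta>' / \<beta>\<close>, \<open>v = 1 - b x\<close> and \<open>u = x / v\<close>, so that the theorem concerns
  \<open>F(u, y v)\<close>. Because the substitution for \<open>y\<close> is linear in \<open>y\<close>, the coefficient of
  \<open>y\<^sup>n\<close> in \<open>F(u, y v)\<close> is \<open>F\<^sub>n(u) v\<^sup>n\<close>, where \<open>F\<^sub>n\<close> is the coefficient of \<open>y\<^sup>n\<close> in \<open>F\<close>.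
  In terms of coefficients the differential equation is the recurrence
  \<open>(n + 1) F\<^sub>n\<^sub>+\<^sub>1 = (\<alpha> + \<gamma> + (\<alpha>' + \<beta>' + \<gamma>') x + n (\<alpha> + \<alpha>' x)) F\<^sub>n + (\<beta> + \<beta>' x) x F\<^sub>n'\<close>,
  so everything reduces to a computation with univariate series.

  The Moebius map \<open>u\<close> transports the vector field \<open>(\<beta> + \<beta>' x) x d/dx\<close> to
  \<open>(\<beta> - \<beta>' x) x d/dx\<close>: this is what \<open>u v = x\<close>, \<open>u' v\<^sup>2 = 1\<close> and
  \<open>(\<beta> + \<beta>' u) v = \<beta>\<close> say together. Substituting \<open>u\<close> in the recurrence and multiplying it by
  \<open>v\<^sup>n\<^sup>+\<^sup>1\<close> therefore gives a recurrence of the same form for \<open>F\<^sub>n(u) v\<^sup>n\<close>. The factor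
  \<open>v\<close> turns each multiplier \<open>p + q u\<close> into \<open>p v + q x = p + (q - p b) x\<close>, and
  differentiating \<open>v\<^sup>n\<close> contributes \<open>n \<beta>' x\<close>; these two effects are exactly the
  change of parameters.
\<close>

text \<open>
  The argument \<open>v\<close> of \<open>y\<close> is a series in \<open>x\<close> alone, hence a scalar over the ring of power
  series in \<open>x\<close>, and scaling the variable scales the coefficients by powers.
\<close>

lemma subst2_linear_nth:
  "subst2 F u (Y2 * fps_const v) $ n = fps_compose (F $ n) u * v ^ n"
  unfolding subst2_def Y2_def mult.commute[of fps_X "fps_const v"] fps_compose_linear
  by simp

text \<open>
  The univariate core: here \<open>f\<close> and \<open>h\<close> stand for consecutive coefficients of \<open>F\<close>, and
  \<open>\<beta>' = \<beta> b\<close>. The series \<open>u\<close> is described by \<open>u v = x\<close> in place of a quotient because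
  differentiating this relation gives \<open>u' v\<^sup>2 = v + b x = 1\<close>, after which all steps are
  polynomial identities without division.
\<close>

lemma moebius_recurrence:
  fixes u v f h :: "complex fps" and b \<beta> p q r s :: complex and n :: nat
  defines "v \<equiv> 1 - fps_const b * fps_X"
  assumes u0: "u $ 0 = 0" and uv: "u * v = fps_X"
    and rec: "of_nat (Suc n) * h =
      (fps_const p + fps_const q * fps_X + of_nat n * (fps_const r + fps_const s * fps_X)) * f
        + (fps_const \<beta> + fps_const (\<beta> * b) * fps_X) * fps_X * fps_deriv f"
  shows "of_nat (Suc n) * (fps_compose h u * v ^ Suc n) =
      (fps_const p + fps_const (q - p * b) * fps_X
         + of_nat n * (fps_const r + fps_const (s + \<beta> * b - r * b) * fps_X))
        * (fps_compose f u * v ^ n)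
      + (fps_const \<beta> + fps_const (- (\<beta> * b)) * fps_X) * fps_X
        * fps_deriv (fps_compose f u * v ^ n)"
proof -
  define B where "B = fps_const b"
  define g where "g = fps_compose f u"
  define w where "w = g * v ^ n"
  have v: "v = 1 - B * fps_X" by (simp add: v_def B_def)
  have dv: "fps_deriv v = - B" by (simp add: v B_def)
  have du: "fps_deriv u * v\<^sup>2 = 1"
  proof -
    have "fps_deriv u * v - u * B = 1"
      using arg_cong[OF uv, of fps_deriv] by (simp add: dv algebra_simps)
    then have "fps_deriv u * v\<^sup>2 = v + B * (u * v)"
      by algebra
    then show ?thesis unfolding uv by (simp add: v)
  qed
  have df: "fps_compose (fps_deriv f) u = v\<^sup>2 * fps_deriv g"
    using du by (simp add: g_def fps_compose_deriv[OF u0] mult.commute mult.left_commute)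
  \<comment> \<open>The factor \<open>v\<close> on the left keeps the exponent \<open>n - 1\<close>, truncated at \<open>n = 0\<close>, out of the
    formula; it is the factor \<open>v\<close> of \<open>\<beta> - \<beta> b x = \<beta> v\<close> in the transformed equation.\<close>
  have dw: "v * fps_deriv w = fps_deriv g * v ^ Suc n - of_nat n * B * w"
  proof -
    have "v * fps_deriv (v ^ n) = - (of_nat n * B * v ^ n)"
      unfolding fps_deriv_power' dv by (cases n) (simp_all add: mult.left_commute)
    then show ?thesis
      by (simp add: w_def distrib_left mult.left_commute[of v] del: fps_deriv_power)
  qed
  have comp: "of_nat (Suc n) * fps_compose h u =
      (fps_const p + fps_const q * u + of_nat n * (fps_const r + fps_const s * u)) * g
        + (fps_const \<beta> + fps_const \<beta> * B * u) * u * (v\<^sup>2 * fps_deriv g)"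
  proof -
    have "fps_compose (of_nat (Suc n) * h) u = of_nat (Suc n) * fps_compose h u"
      by (simp only: fps_of_nat[symmetric] fps_compose_mult_distrib[OF u0] fps_const_compose)
    then show ?thesis
      unfolding rec
      by (simp only: fps_of_nat[symmetric] fps_compose_mult_distrib[OF u0] fps_const_compose
          fps_compose_add_distrib fps_X_fps_compose_startby0[OF u0] df B_def fps_const_mult
          g_def[symmetric])
  qed
  have "of_nat (Suc n) * (fps_compose h u * v ^ Suc n) =
      (of_nat (Suc n) * fps_compose h u) * v ^ Suc n"
    by (simp only: mult.assoc)
  \<comment> \<open>The extra factor \<open>v\<close> turns the multipliers of \<open>g\<close> into polynomials; the factor \<open>v\<^sup>2\<close> of
    the derivative clears the denominators of \<open>\<beta> + \<beta> b u\<close> and \<open>u\<close>.\<close>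
  also have "\<dots> =
      (fps_const p * v + fps_const q * (u * v)
         + of_nat n * (fps_const r * v + fps_const s * (u * v))) * w
      + fps_const \<beta> * (v + B * (u * v)) * (u * v) * (fps_deriv g * v ^ Suc n)"
    unfolding comp w_def by (simp only: power_Suc power2_eq_square) algebra
  also have "\<dots> =
      (fps_const p * v + fps_const q * fps_X
         + of_nat n * (fps_const r * v + fps_const s * fps_X)) * w
      + fps_const \<beta> * fps_X * (v * fps_deriv w + of_nat n * B * w)"
  proof -
    have "v + B * fps_X = 1" by (simp add: v)
    then show ?thesis unfolding uv dw by simp
  qed
  also have "\<dots> =
      (fps_const p + fps_const (q - p * b) * fps_X
         + of_nat n * (fps_const r + fps_const (s + \<beta> * b - r * b) * fps_X)) * w
      + (fps_const \<beta> + fps_const (- (\<beta> * b)) * fps_X) * fps_X * fps_deriv w"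
  proof -
    have c: "fps_const (q - p * b) = fps_const q - fps_const p * B"
      "fps_const (s + \<beta> * b - r * b) = fps_const s + fps_const \<beta> * B - fps_const r * B"
      "fps_const (- (\<beta> * b)) = - (fps_const \<beta> * B)"
      by (simp_all add: B_def)
    show ?thesis unfolding c v by algebra
  qed
  finally show ?thesis by (simp only: w_def g_def)
qed

theorem proposition17:
  fixes \<alpha> \<beta> \<gamma> \<alpha>' \<beta>' \<gamma>' :: complex and F :: fps2
  assumes "\<beta> \<noteq> 0"
    and "solves_pde \<alpha> \<beta> \<gamma> \<alpha>' \<beta>' \<gamma>' F"
    and "at_y0 F = 1"
  defines "Fhat \<equiv>
    subst2 F
      (fps_const \<beta> * fps_X / (fps_const \<beta> - fps_const \<beta>' * fps_X))
      (Y2 * fps_const ((fps_const \<beta> - fps_const \<beta>' * fps_X) / fps_const \<beta>))"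
  shows "solves_pde \<alpha> \<beta> \<gamma>
           (\<alpha>' + \<beta>' - \<alpha> * \<beta>' / \<beta>) (- \<beta>') (\<gamma>' + \<beta>' - \<gamma> * \<beta>' / \<beta>) Fhat
         \<and> at_y0 Fhat = 1"
proof -
  define b where "b = \<beta>' / \<beta>"
  define d where "d = fps_const \<beta> - fps_const \<beta>' * fps_X"
  define u where "u = fps_const \<beta> * fps_X / d"
  define v where "v = 1 - fps_const b * fps_X"
  have \<beta>': "\<beta>' = \<beta> * b" using \<open>\<beta> \<noteq> 0\<close> by (simp add: b_def)
  have d0: "d $ 0 \<noteq> 0" using \<open>\<beta> \<noteq> 0\<close> by (simp add: d_def)
  have dv: "d = fps_const \<beta> * v"
    unfolding d_def v_def \<beta>' by (simp add: algebra_simps flip: fps_const_mult)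
  have v_eq: "d / fps_const \<beta> = v"
    using \<open>\<beta> \<noteq> 0\<close> unfolding dv by simp
  have u0: "u $ 0 = 0" by (simp add: u_def fps_divide_unit[OF d0])
  have "u * d = fps_const \<beta> * fps_X"
    using inverse_mult_eq_1[OF d0] by (simp add: u_def fps_divide_unit[OF d0] mult.assoc)
  then have "fps_const \<beta> * (u * v) = fps_const \<beta> * fps_X"
    by (simp add: dv mult.left_commute)
  then have uv: "u * v = fps_X"
    using \<open>\<beta> \<noteq> 0\<close> by simp
  have Fhat: "Fhat $ n = fps_compose (F $ n) u * v ^ n" for n
    unfolding Fhat_def d_def[symmetric] u_def[symmetric] v_eq by (rule subst2_linear_nth)
  have "at_y0 Fhat = 1"
    using \<open>at_y0 F = 1\<close> by (simp add: at_y0_def Fhat)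
  moreover have "solves_pde \<alpha> \<beta> \<gamma>
      (\<alpha>' + \<beta>' - \<alpha> * \<beta>' / \<beta>) (- \<beta>') (\<gamma>' + \<beta>' - \<gamma> * \<beta>' / \<beta>) Fhat"
    unfolding solves_pde_iff
  proof
    fix n
    have params: "\<alpha>' + \<beta>' - \<alpha> * \<beta>' / \<beta> = \<alpha>' + \<beta> * b - \<alpha> * b"
      "(\<alpha>' + \<beta>' - \<alpha> * \<beta>' / \<beta>) + - \<beta>' + (\<gamma>' + \<beta>' - \<gamma> * \<beta>' / \<beta>)
        = (\<alpha>' + \<beta>' + \<gamma>') - (\<alpha> + \<gamma>) * b"
      "- \<beta>' = - (\<beta> * b)"
      using \<open>\<beta> \<noteq> 0\<close> by (simp_all add: \<beta>' algebra_simps)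
    have "of_nat (Suc n) * F $ Suc n =
        (fps_const (\<alpha> + \<gamma>) + fps_const (\<alpha>' + \<beta>' + \<gamma>') * fps_X
           + of_nat n * (fps_const \<alpha> + fps_const \<alpha>' * fps_X)) * F $ n
        + (fps_const \<beta> + fps_const (\<beta> * b) * fps_X) * fps_X * fps_deriv (F $ n)"
      using assms(2) unfolding solves_pde_iff \<beta>'[symmetric] by blast
    from moebius_recurrence[OF u0 uv[unfolded v_def] this]
    show "of_nat (Suc n) * Fhat $ Suc n =
        (fps_const (\<alpha> + \<gamma>)
           + fps_const ((\<alpha>' + \<beta>' - \<alpha> * \<beta>' / \<beta>) + - \<beta>' + (\<gamma>' + \<beta>' - \<gamma> * \<beta>' / \<beta>)) * fps_X
           + of_nat n * (fps_const \<alpha> + fps_const (\<alpha>' + \<beta>' - \<alpha> * \<beta>' / \<beta>) * fps_X)) * Fhat $ n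
        + (fps_const \<beta> + fps_const (- \<beta>') * fps_X) * fps_X * fps_deriv (Fhat $ n)"
      unfolding params(2) unfolding params(1,3) Fhat v_def .
  qed
  ultimately show ?thesis by simp
qed

end
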